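(* Let $(\Omega,\mathcal{F},\mu)$ be a measure space. Let $I\in\mathcal{F}$ be of finite measure, and let $b$ be a measurable complex-valued function on $I$. Then there exist two orthogonal lines $L_1$ and $L_2$ in $\mathbb{C}$ which divide $\mathbb{C}$ into four closed quadrants $T_1,T_2,T_3,T_4$ such that $$\mu(\{x\in I:b(x)\in T_i\})\ge\frac1{16}\mu(I),\qquad i\in\{1,2,3,4\}.$$ *)

theory Defs
  imports "HOL-Analysis.Analysis"
begin

text \<open>Lines are affine: they need not pass through the origin.\<close>

definition complex_line :: "complex set \<Rightarrow> bool" where
  "complex_line L \<longleftrightarrow> affine L \<and> aff_dim L = 1"

text \<open>Orthogonality is for the real inner product on the complex plane and concerns the
  directions of the two lines.\<close>

definition orthogonal_lines :: "complex set \<Rightarrow> complex set \<Rightarrow> bool" where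
  "orthogonal_lines L1 L2 \<longleftrightarrow> complex_line L1 \<and> complex_line L2 \<and>
     (\<forall>a\<in>L1. \<forall>b\<in>L1. \<forall>c\<in>L2. \<forall>d\<in>L2. orthogonal (b - a) (d - c))"

text \<open>Removing two orthogonal lines leaves the open quadrants as connected components;
  the closed quadrants are their closures.\<close>

definition closed_quadrants :: "complex set \<Rightarrow> complex set \<Rightarrow> complex set set" where
  "closed_quadrants L1 L2 = closure ` components (- (L1 \<union> L2))"

end

theory Submission
  imports Defs
begin

text \<open>
  The proof gives the stronger constant $1/4$, for every nonzero finite Borel measure on the
  plane (here the distribution of the values of the function), atoms included.

  A frame is a unit vector \<open>w\<close> with a centre \<open>c\<close>: it stands for the two lines through \<open>c\<close> that are
  normal to \<open>w\<close> and to \<open>\<i> * w\<close>. Consider the frames whose four closed half-planes all carry at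
  least half of the mass. Each half-plane is the union of two adjacent quadrants, so if a quadrant
  carries less than a quarter, then both of its neighbours carry more than a quarter. Hence in every
  bisecting frame some opposite pair of quadrants is large, meaning that both carry at least a quarter
  (\<open>opposite_quadrants_large\<close>). Let \<open>A\<close> and \<open>B\<close> be the sets of bisecting frames in which the first,
  respectively the second, opposite pair is large. A quarter turn of \<open>w\<close> exchanges the two pairs,
  so \<open>A\<close> and \<open>B\<close> are both nonempty. It remains to see that the space of bisecting frames is
  connected and that \<open>A\<close> and \<open>B\<close> are closed in it, for then they share a frame, and in that frame all
  four quadrants are large.

  When the measure has atoms or gaps, the bisecting lines of a given direction are neither unique nor
  a continuous function of the direction, so rotating one chosen pair of bisectors is no option.
  Keeping all bisecting centres repairs this: the mass of a closed set
  is upper semicontinuous under perturbation of the set (\<open>closed_superlevel_measure_section\<close>), so all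
  the sets involved are closed, indeed compact; and over each direction the bisecting centres form
  a nonempty convex set. A compact space that lies over the circle with connected nonempty fibres is connected
  (\<open>compact_cover_connected_fibres_meet\<close>).
\<close>

section \<open>Superlevel sets of the measure of a moving closed set\<close>

text \<open>
  Along a convergent sequence of parameters, the limit superior of the sections lies in the section
  at the limit, because \<open>G\<close> is closed; continuity from above of a finite measure bounds the mass
  of that limit superior from below.
\<close>

lemma closed_superlevel_measure_section:
  fixes G :: "('p::first_countable_topology \<times> 'q::first_countable_topology) set"
  assumes nu: "finite_measure N" "sets N = sets borel" and G: "closed G"
  shows "closed {p. r \<le> measure N {z. (p, z) \<in> G}}"
  unfolding closed_sequential_limits
proof (intro allI impI, elim conjE)
  interpret finite_measure N by (rule nu)
  fix p l assume p: "\<forall>n. p n \<in> {p. r \<le> measure N {z. (p, z) \<in> G}}" and l: "p \<longlonglongrightarrow> l"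
  have "closed {z. (q, z) \<in> G}" for q
    using closed_vimage[OF G, of "Pair q"] by (simp add: vimage_def continuous_on_Pair)
  then have meas: "{z. (q, z) \<in> G} \<in> sets N" for q
    by (simp add: nu(2))
  \<comment> \<open>The intersection of the decreasing sets \<open>U n\<close> is the limit superior of the sections.\<close>
  define U where "U n = (\<Union>k\<in>{n..}. {z. (p k, z) \<in> G})" for n
  have U_meas: "U n \<in> sets N" for n
    unfolding U_def by (intro sets.countable_UN'' meas) auto
  have "decseq U"
    unfolding U_def decseq_def by force
  then have lim: "(\<lambda>n. measure N (U n)) \<longlonglongrightarrow> measure N (\<Inter>n. U n)"
    using U_meas by (intro finite_Lim_measure_decseq) auto
  have "r \<le> measure N (U n)" for n
  proof -
    have "r \<le> measure N {z. (p n, z) \<in> G}" using p by auto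
    also have "\<dots> \<le> measure N (U n)"
      by (intro finite_measure_mono U_meas) (auto simp: U_def)
    finally show ?thesis .
  qed
  then have "r \<le> measure N (\<Inter>n. U n)"
    by (intro LIMSEQ_le_const[OF lim]) auto
  also have "\<dots> \<le> measure N {z. (l, z) \<in> G}"
  proof (intro finite_measure_mono meas subsetI)
    fix z assume "z \<in> (\<Inter>n. U n)"
    then have "\<forall>n. \<exists>k\<ge>n. (p k, z) \<in> G" by (auto simp: U_def)
    then obtain s where s: "\<And>n. s n \<ge> n" "\<And>n. (p (s n), z) \<in> G" by metis
    have "filterlim s at_top sequentially"
      using s(1) by (intro filterlim_at_top_mono[OF filterlim_ident]) auto
    then have "(\<lambda>n. p (s n)) \<longlonglongrightarrow> l"
      using l by (rule filterlim_compose[rotated])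
    then have "(\<lambda>n. (p (s n), z)) \<longlonglongrightarrow> (l, z)"
      by (intro tendsto_Pair) auto
    then show "z \<in> {z. (l, z) \<in> G}"
      using closed_sequentially[OF G s(2)] by simp
  qed
  finally show "l \<in> {p. r \<le> measure N {z. (p, z) \<in> G}}" by simp
qed

section \<open>Compact covers with connected fibres\<close>

text \<open>
  The base is covered by the two projections, which are closed by compactness, so some fibre meets
  both \<open>A\<close> and \<open>B\<close>; that fibre is connected and covered by its two closed traces.
\<close>

lemma compact_cover_connected_fibres_meet:
  fixes A B :: "('p::t2_space \<times> 'q::t2_space) set"
  assumes "compact A" "compact B" "connected (fst ` (A \<union> B))"
    and fib: "\<And>p. connected {c. (p, c) \<in> A \<union> B}"
    and ne: "A \<noteq> {}" "B \<noteq> {}"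
  shows "A \<inter> B \<noteq> {}"
proof -
  have cl: "closed (fst ` A)" "closed (fst ` B)"
    using assms(1,2) by (auto intro!: compact_imp_closed compact_continuous_image continuous_on_fst)
  have "fst ` A \<inter> fst ` B \<noteq> {}"
  proof
    assume *: "fst ` A \<inter> fst ` B = {}"
    show False
      using connected_closedD[OF assms(3) _ _ cl] * ne by (auto simp: image_Un)
  qed
  then obtain p c d where pc: "(p, c) \<in> A" "(p, d) \<in> B" by force
  have fcl: "closed {c. (p, c) \<in> S}" if "compact S" for S :: "('p \<times> 'q) set"
    using closed_vimage[OF compact_imp_closed[OF that], of "Pair p"]
    by (simp add: vimage_def continuous_on_Pair)
  show ?thesis
    using connected_closedD[OF fib _ _ fcl[OF assms(1)] fcl[OF assms(2)], of p] pc by blast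
qed

section \<open>Half-planes and quadrants\<close>

definition half_plane :: "complex \<Rightarrow> complex \<Rightarrow> complex set" where
  "half_plane w c = {z. w \<bullet> c \<le> w \<bullet> z}"

definition quadrant :: "complex \<Rightarrow> complex \<Rightarrow> complex set" where
  "quadrant w c = half_plane w c \<inter> half_plane (\<i> * w) c"

lemma closed_half_plane: "closed (half_plane w c)"
  unfolding half_plane_def by (intro closed_Collect_le continuous_intros)

lemma closed_quadrant: "closed (quadrant w c)"
  unfolding quadrant_def by (intro closed_Int closed_half_plane)

text \<open>
  The quadrants of a frame in cyclic order are those of \<open>w\<close>, \<open>\<i> * w\<close>, \<open>- w\<close> and \<open>- \<i> * w\<close>.
  The half-plane of \<open>w\<close> is made of the quadrants spanned by \<open>w\<close> with \<open>\<i> * w\<close> and by \<open>w\<close> with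
  \<open>- \<i> * w\<close>; the latter starts at \<open>- \<i> * w\<close>.
\<close>

lemma half_plane_split: "half_plane w c = quadrant w c \<union> quadrant (- \<i> * w) c"
  by (auto simp: quadrant_def half_plane_def)

text \<open>Parseval's identity for the orthonormal basis \<open>w\<close>, \<open>\<i> * w\<close> of the plane.\<close>

lemma inner_rotated_frame:
  fixes w x y :: complex
  assumes "norm w = 1"
  shows "x \<bullet> y = (w \<bullet> x) * (w \<bullet> y) + ((\<i> * w) \<bullet> x) * ((\<i> * w) \<bullet> y)"
proof -
  have "(Re w)\<^sup>2 + (Im w)\<^sup>2 = 1"
    using assms by (simp add: cmod_def)
  moreover have "(w \<bullet> x) * (w \<bullet> y) + ((\<i> * w) \<bullet> x) * ((\<i> * w) \<bullet> y) = ((Re w)\<^sup>2 + (Im w)\<^sup>2) * (x \<bullet> y)"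
    by (simp add: inner_complex_def algebra_simps power2_eq_square)
  ultimately show ?thesis by simp
qed

lemma inner_frame:
  fixes w :: complex
  assumes "norm w = 1"
  shows "w \<bullet> w = 1" "(\<i> * w) \<bullet> (\<i> * w) = 1" "w \<bullet> (\<i> * w) = 0" "(\<i> * w) \<bullet> w = 0"
  using assms by (auto simp: dot_square_norm norm_mult inner_complex_def)

lemma interior_half_plane:
  "w \<noteq> 0 \<Longrightarrow> interior (half_plane w c) = {z. w \<bullet> c < w \<bullet> z}"
  unfolding half_plane_def using interior_halfspace_ge[of w "w \<bullet> c"] by simp

lemma interior_quadrant:
  "w \<noteq> 0 \<Longrightarrow> interior (quadrant w c) = {z. w \<bullet> c < w \<bullet> z \<and> (\<i> * w) \<bullet> c < (\<i> * w) \<bullet> z}"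
  unfolding quadrant_def by (auto simp: interior_half_plane)

lemma convex_quadrant: "convex (quadrant w c)"
  unfolding quadrant_def half_plane_def
  by (intro convex_Int convex_halfspace_ge)

lemma corner_in_interior_quadrant:
  assumes "norm w = 1"
  shows "c + w + \<i> * w \<in> interior (quadrant w c)"
proof -
  have "w \<noteq> 0" using assms by auto
  then show ?thesis by (simp add: interior_quadrant inner_add_right inner_frame[OF assms])
qed

lemma closure_interior_quadrant:
  assumes "norm w = 1"
  shows "closure (interior (quadrant w c)) = quadrant w c"
  using convex_closure_interior[OF convex_quadrant] corner_in_interior_quadrant[OF assms]
    closed_quadrant by (metis closure_closed empty_iff)

text \<open>
  This identifies the topologically defined closed quadrants of a pair of lines. The four open
  quadrants are open, convex and disjoint and fill the complement of the lines, so they are its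
  components; a closed convex set with nonempty interior is the closure of that interior.
\<close>

lemma closed_quadrants_of_frame:
  fixes w c :: complex
  assumes w: "norm w = 1"
  defines "L1 \<equiv> {z. w \<bullet> z = w \<bullet> c}" and "L2 \<equiv> {z. (\<i> * w) \<bullet> z = (\<i> * w) \<bullet> c}"
  shows "orthogonal_lines L1 L2"
    and "closed_quadrants L1 L2 = (\<lambda>n. quadrant (\<i> ^ n * w) c) ` {1, 2, 3, 4 :: nat}"
    and "inj_on (\<lambda>n. quadrant (\<i> ^ n * w) c) {1, 2, 3, 4 :: nat}"
proof -
  have w0: "w \<noteq> 0" using w by auto
  have "complex_line L1" "complex_line L2"
    using w0 by (simp_all add: complex_line_def L1_def L2_def affine_hyperplane)
  moreover have "orthogonal (b - a) (d - e)" if "a \<in> L1" "b \<in> L1" "d \<in> L2" "e \<in> L2" for a b d e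
    using that inner_rotated_frame[OF w, of "b - a" "d - e"]
    by (simp add: orthogonal_def L1_def L2_def inner_diff_right)
  ultimately show "orthogonal_lines L1 L2"
    by (simp add: orthogonal_lines_def)
  define Q where "Q n = quadrant (\<i> ^ n * w) c" for n
  have unit: "norm (\<i> ^ n * w) = 1" for n
    using w by (simp add: norm_mult norm_power)
  have pow: "\<i> ^ 3 = - \<i>" "\<i> ^ 4 = 1" "\<i> ^ 2 = -1" "\<i> ^ 1 = \<i>" "\<i> ^ Suc 0 = \<i>"
    by (simp_all add: eval_nat_numeral)
  have int: "interior (Q n) =
      {z. (\<i> ^ n * w) \<bullet> c < (\<i> ^ n * w) \<bullet> z \<and> (\<i> * (\<i> ^ n * w)) \<bullet> c < (\<i> * (\<i> ^ n * w)) \<bullet> z}" for n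
    unfolding Q_def using w0 by (intro interior_quadrant) simp
  have ne: "interior (Q n) \<noteq> {}" for n
    unfolding Q_def using corner_in_interior_quadrant[OF unit] by blast
  have disj: "interior (Q m) \<inter> interior (Q n) = {}" if "m \<in> {1,2,3,4}" "n \<in> {1,2,3,4}" "m \<noteq> n" for m n
    using that by (auto simp: int pow)
  show "inj_on (\<lambda>n. quadrant (\<i> ^ n * w) c) {1, 2, 3, 4 :: nat}"
    unfolding Q_def[symmetric]
  proof (rule inj_onI, rule ccontr)
    fix m n :: nat assume "m \<in> {1,2,3,4}" "n \<in> {1,2,3,4}" "Q m = Q n" "m \<noteq> n"
    then show False using disj[of m n] ne[of n] by simp
  qed
  have "components (- (L1 \<union> L2)) = (\<lambda>n. interior (Q n)) ` {1, 2, 3, 4 :: nat}"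
  proof (rule components_open_unique)
    show "pairwise disjnt ((\<lambda>n. interior (Q n)) ` {1, 2, 3, 4 :: nat})"
      unfolding pairwise_image by (rule pairwiseI) (simp add: disj disjnt_def)
    \<comment> \<open>Off both lines, the signs of the two coordinates of \<open>z - c\<close> select the quadrant.\<close>
    show "\<Union> ((\<lambda>n. interior (Q n)) ` {1, 2, 3, 4 :: nat}) = - (L1 \<union> L2)"
    proof -
      have "interior (Q 1) = {z. (\<i> * w) \<bullet> c < (\<i> * w) \<bullet> z \<and> w \<bullet> z < w \<bullet> c}"
        "interior (Q 2) = {z. w \<bullet> z < w \<bullet> c \<and> (\<i> * w) \<bullet> z < (\<i> * w) \<bullet> c}"
        "interior (Q 3) = {z. (\<i> * w) \<bullet> z < (\<i> * w) \<bullet> c \<and> w \<bullet> c < w \<bullet> z}"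
        "interior (Q 4) = {z. w \<bullet> c < w \<bullet> z \<and> (\<i> * w) \<bullet> c < (\<i> * w) \<bullet> z}"
        by (simp_all add: int pow mult.assoc[symmetric])
      then show ?thesis
        by (intro set_eqI) (auto simp: L1_def L2_def neq_iff)
    qed
  next
    fix X assume "X \<in> (\<lambda>n. interior (Q n)) ` {1, 2, 3, 4 :: nat}"
    then obtain n where X: "X = interior (Q n)" by blast
    then show "open X \<and> connected X \<and> X \<noteq> {}"
      using ne convex_interior[OF convex_quadrant] by (auto simp: Q_def intro: convex_connected)
  qed
  then have "closed_quadrants L1 L2 = (\<lambda>n. closure (interior (Q n))) ` {1, 2, 3, 4 :: nat}"
    unfolding closed_quadrants_def by (simp add: image_image)
  also have "(\<lambda>n. closure (interior (Q n))) = Q"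
    unfolding Q_def using closure_interior_quadrant[OF unit] by blast
  finally show "closed_quadrants L1 L2 = (\<lambda>n. quadrant (\<i> ^ n * w) c) ` {1, 2, 3, 4 :: nat}"
    unfolding Q_def .
qed

section \<open>Orthogonal bisecting lines\<close>

text \<open>
  The line through \<open>c\<close> normal to \<open>w\<close> is a median line. Both half-planes are closed, so mass on the line
  counts on either side; this is why such a line exists even for measures with atoms.
\<close>

definition bisects :: "complex measure \<Rightarrow> complex \<Rightarrow> complex \<Rightarrow> bool" where
  "bisects N w c \<longleftrightarrow> measure N UNIV / 2 \<le> measure N (half_plane w c) \<and>
     measure N UNIV / 2 \<le> measure N (half_plane (- w) c)"

locale planar_mass = finite_measure N for N :: "complex measure" +
  assumes sets_N: "sets N = sets borel" and positive: "measure N UNIV > 0"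
begin

abbreviation "mass \<equiv> measure N UNIV"

lemma meas: "closed S \<Longrightarrow> S \<in> sets N"
  by (simp add: sets_N)

lemma exists_cball_large_mass:
  assumes "r < mass"
  shows "\<exists>R. r < measure N (cball 0 R)"
proof -
  have "(\<lambda>n. measure N (cball 0 (real n))) \<longlonglongrightarrow> measure N (\<Union>n. cball 0 (real n))"
    by (intro finite_Lim_measure_incseq) (auto simp: sets_N incseq_def)
  also have "(\<Union>n. cball (0::complex) (real n)) = UNIV"
    using real_arch_simple by auto
  finally have "\<forall>\<^sub>F n in sequentially. r < measure N (cball 0 (real n))"
    using assms by (rule order_tendstoD(1))
  then show ?thesis
    using eventually_happens by fastforce
qed

text \<open>
  A half-plane with half of the mass must meet a fixed disc that carries more than half of it. This
  confines the bisecting centres to a bounded region, uniformly in the direction.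
\<close>

lemma half_mass_bounded:
  "\<exists>R. \<forall>w c. norm w = 1 \<and> mass / 2 \<le> measure N (half_plane w c) \<longrightarrow> w \<bullet> c \<le> R"
proof -
  obtain R where R: "mass / 2 < measure N (cball 0 R)"
    using exists_cball_large_mass[of "mass / 2"] positive by auto
  have "w \<bullet> c \<le> R" if w: "norm w = 1" "mass / 2 \<le> measure N (half_plane w c)" for w c
  proof (rule ccontr)
    assume *: "\<not> w \<bullet> c \<le> R"
    have "half_plane w c \<inter> cball 0 R = {}"
    proof (rule ccontr)
      assume "half_plane w c \<inter> cball 0 R \<noteq> {}"
      then obtain z where z: "w \<bullet> c \<le> w \<bullet> z" "norm z \<le> R"
        by (auto simp: half_plane_def)
      then show False using * norm_cauchy_schwarz[of w z] w(1) by simp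
    qed
    then have "measure N (half_plane w c) + measure N (cball 0 R) = measure N (half_plane w c \<union> cball 0 R)"
      by (intro finite_measure_Union[symmetric] meas closed_half_plane closed_cball)
    also have "\<dots> \<le> mass"
      by (intro finite_measure_mono meas) auto
    finally show False using w(2) R by simp
  qed
  then show ?thesis by blast
qed

lemma closed_superlevel_half_plane:
  assumes "continuous_on UNIV f"
  shows "closed {p :: complex \<times> complex. r \<le> measure N (half_plane (f (fst p)) (snd p))}"
proof -
  have f: "continuous_on S (\<lambda>x. f (g x))" if "continuous_on S g" for S and g :: "(complex \<times> complex) \<times> complex \<Rightarrow> complex"
    by (rule continuous_on_compose2[OF assms that]) simp
  have "closed {q :: (complex \<times> complex) \<times> complex. f (fst (fst q)) \<bullet> snd (fst q) \<le> f (fst (fst q)) \<bullet> snd q}"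
    by (intro closed_Collect_le continuous_intros f)
  from closed_superlevel_measure_section[OF finite_measure_axioms sets_N this, of r]
  show ?thesis by (simp add: half_plane_def)
qed

lemma closed_superlevel_quadrant:
  assumes "continuous_on UNIV f"
  shows "closed {p :: complex \<times> complex. r \<le> measure N (quadrant (f (fst p)) (snd p))}"
proof -
  have f: "continuous_on S (\<lambda>x. f (g x))" if "continuous_on S g" for S and g :: "(complex \<times> complex) \<times> complex \<Rightarrow> complex"
    by (rule continuous_on_compose2[OF assms that]) simp
  have "closed {q :: (complex \<times> complex) \<times> complex. f (fst (fst q)) \<bullet> snd (fst q) \<le> f (fst (fst q)) \<bullet> snd q
     \<and> (\<i> * f (fst (fst q))) \<bullet> snd (fst q) \<le> (\<i> * f (fst (fst q))) \<bullet> snd q}"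
    by (intro closed_Collect_conj closed_Collect_le continuous_intros f)
  from closed_superlevel_measure_section[OF finite_measure_axioms sets_N this, of r]
  show ?thesis by (simp add: half_plane_def quadrant_def Collect_conj_eq)
qed

text \<open>
  Half-planes with a common normal \<open>w\<close> are nested according to \<open>w \<bullet> c\<close>, so the superlevel set is
  the preimage of an interval under a linear functional.
\<close>

lemma convex_superlevel_half_plane: "convex {c. r \<le> measure N (half_plane w c)}"
proof (rule convexI, clarsimp)
  fix x y :: complex and u v :: real
  assume *: "r \<le> measure N (half_plane w x)" "r \<le> measure N (half_plane w y)" "0 \<le> u" "0 \<le> v" "u + v = 1"
  have "w \<bullet> (u *\<^sub>R x + v *\<^sub>R y) \<le> max (w \<bullet> x) (w \<bullet> y)"
    using * convex_bound_le[of "w \<bullet> x" "max (w \<bullet> x) (w \<bullet> y)" "w \<bullet> y" u v]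
    by (simp add: inner_add_right)
  then have "half_plane w x \<subseteq> half_plane w (u *\<^sub>R x + v *\<^sub>R y) \<or> half_plane w y \<subseteq> half_plane w (u *\<^sub>R x + v *\<^sub>R y)"
    unfolding half_plane_def by (auto simp: max_def split: if_splits)
  then show "r \<le> measure N (half_plane w (u *\<^sub>R x + v *\<^sub>R y))"
    using * finite_measure_mono[OF _ meas[OF closed_half_plane]] by (meson order_trans)
qed

lemma mass_half_plane_antipodal:
  "mass \<le> measure N (half_plane w c) + measure N (half_plane (- w) c)"
proof -
  have "half_plane w c \<union> half_plane (- w) c = UNIV"
    by (auto simp: half_plane_def)
  then show ?thesis
    using measure_Un_le[OF meas meas, OF closed_half_plane closed_half_plane, of w c "- w" c] by simp
qed

lemma mass_half_plane_quadrants: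
  "measure N (half_plane w c) \<le> measure N (quadrant w c) + measure N (quadrant (- \<i> * w) c)"
  unfolding half_plane_split by (intro measure_Un_le meas closed_quadrant)

text \<open>
  Existence of a median by connectedness of the real line: the heights with enough mass above and
  those with enough mass below form two closed sets that cover the line, and neither is empty since the
  mass is concentrated in a bounded region.
\<close>

lemma exists_bisecting_height:
  assumes w: "norm w = 1"
  shows "\<exists>s. \<forall>c. w \<bullet> c = s \<longrightarrow> bisects N w c"
proof -
  obtain R where R: "\<And>w c. norm w = 1 \<Longrightarrow> mass / 2 \<le> measure N (half_plane w c) \<Longrightarrow> w \<bullet> c \<le> R"
    using half_mass_bounded by blast
  have ww: "w \<bullet> w = 1" using w by (simp add: dot_square_norm)
  define S where "S v = {s. mass / 2 \<le> measure N (half_plane v (s *\<^sub>R w))}" for v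
  have cl: "closed (S v)" for v
  proof -
    have "closed ((\<lambda>s. (v, s *\<^sub>R w)) -` {p :: complex \<times> complex. mass / 2 \<le> measure N (half_plane (fst p) (snd p))})"
      by (intro closed_vimage closed_superlevel_half_plane continuous_intros)
    then show ?thesis by (simp add: S_def vimage_def)
  qed
  have cover: "UNIV \<subseteq> S w \<union> S (- w)"
  proof
    fix s :: real
    show "s \<in> S w \<union> S (- w)"
      using mass_half_plane_antipodal[of w "s *\<^sub>R w"] by (auto simp: S_def)
  qed
  have "R + 1 \<notin> S w" "- (R + 1) \<notin> S (- w)"
    using R[of w "(R + 1) *\<^sub>R w"] R[of "- w" "(- (R + 1)) *\<^sub>R w"] w ww by (auto simp: S_def)
  with cover have "R + 1 \<in> S (- w)" "- (R + 1) \<in> S w" by blast+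
  then obtain s where s: "s \<in> S w" "s \<in> S (- w)"
    using connected_closedD[OF connected_UNIV _ cover cl cl] by blast
  have "bisects N w c" if "w \<bullet> c = s" for c
  proof -
    have "half_plane w c = half_plane w (s *\<^sub>R w)" "half_plane (- w) c = half_plane (- w) (s *\<^sub>R w)"
      using that ww by (auto simp: half_plane_def)
    then show ?thesis using s by (simp add: bisects_def S_def)
  qed
  then show ?thesis by blast
qed

lemma exists_bisecting_centre:
  assumes w: "norm w = 1"
  shows "\<exists>c. bisects N w c \<and> bisects N (\<i> * w) c"
proof -
  have "norm (\<i> * w) = 1" using w by (simp add: norm_mult)
  then obtain s t where s: "\<And>c. w \<bullet> c = s \<Longrightarrow> bisects N w c"
    and t: "\<And>c. (\<i> * w) \<bullet> c = t \<Longrightarrow> bisects N (\<i> * w) c"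
    using exists_bisecting_height w by meson
  have "w \<bullet> (s *\<^sub>R w + t *\<^sub>R (\<i> * w)) = s" "(\<i> * w) \<bullet> (s *\<^sub>R w + t *\<^sub>R (\<i> * w)) = t"
    using inner_frame[OF w] by (auto simp only: inner_add_right inner_scaleR_right)
  then show ?thesis using s t by blast
qed

definition bisecting_frames :: "(complex \<times> complex) set" where
  "bisecting_frames = {(w, c). norm w = 1 \<and> bisects N w c \<and> bisects N (\<i> * w) c}"

lemma bisecting_frames_rotate:
  "(w, c) \<in> bisecting_frames \<Longrightarrow> (\<i> * w, c) \<in> bisecting_frames"
  by (auto simp: bisecting_frames_def bisects_def norm_mult)

lemma compact_bisecting_frames: "compact bisecting_frames"
proof -
  obtain R where R: "\<And>w c. norm w = 1 \<Longrightarrow> mass / 2 \<le> measure N (half_plane w c) \<Longrightarrow> w \<bullet> c \<le> R"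
    using half_mass_bounded by blast
  have "norm c \<le> 2 * R" if "(w, c) \<in> bisecting_frames" for w c
  proof -
    from that have w: "norm w = 1" and bis: "bisects N w c" "bisects N (\<i> * w) c"
      by (auto simp: bisecting_frames_def)
    have le: "\<bar>w \<bullet> c\<bar> \<le> R" "\<bar>(\<i> * w) \<bullet> c\<bar> \<le> R"
      using bis w R[of w c] R[of "- w" c] R[of "\<i> * w" c] R[of "- (\<i> * w)" c]
      by (auto simp: bisects_def norm_mult abs_le_iff)
    then have "0 \<le> R" by linarith
    have "(norm c)\<^sup>2 = (w \<bullet> c)\<^sup>2 + ((\<i> * w) \<bullet> c)\<^sup>2"
      using inner_rotated_frame[OF w, of c c] by (metis power2_norm_eq_inner power2_eq_square)
    also have "\<dots> \<le> R\<^sup>2 + R\<^sup>2"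
      using le by (intro add_mono) (metis abs_ge_zero power2_abs power_mono)+
    also have "\<dots> \<le> (2 * R)\<^sup>2" by (simp add: power2_eq_square)
    finally show ?thesis by (rule power2_le_imp_le) (use \<open>0 \<le> R\<close> in simp)
  qed
  then have "bisecting_frames \<subseteq> cball 0 1 \<times> cball 0 (2 * R)"
    by (auto simp: bisecting_frames_def)
  then have "bounded bisecting_frames"
    by (rule bounded_subset[rotated]) (intro bounded_Times bounded_cball)
  moreover have "closed bisecting_frames"
  proof -
    have "bisecting_frames = {p. norm (fst p) = 1} \<inter>
      ({p. mass / 2 \<le> measure N (half_plane (fst p) (snd p))} \<inter>
       {p. mass / 2 \<le> measure N (half_plane (- fst p) (snd p))} \<inter>
       {p. mass / 2 \<le> measure N (half_plane (\<i> * fst p) (snd p))} \<inter>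
       {p. mass / 2 \<le> measure N (half_plane (- (\<i> * fst p)) (snd p))})"
      by (auto simp: bisecting_frames_def bisects_def)
    moreover have "closed \<dots>"
      by (intro closed_Int closed_superlevel_half_plane closed_Collect_eq continuous_intros)
    ultimately show ?thesis by simp
  qed
  ultimately show ?thesis by (simp add: compact_eq_bounded_closed)
qed

lemma convex_bisecting_centres: "convex {c. (w, c) \<in> bisecting_frames}"
proof (cases "norm w = 1")
  case True
  then have "{c. (w, c) \<in> bisecting_frames} =
      {c. mass / 2 \<le> measure N (half_plane w c)} \<inter> {c. mass / 2 \<le> measure N (half_plane (- w) c)} \<inter>
      {c. mass / 2 \<le> measure N (half_plane (\<i> * w) c)} \<inter> {c. mass / 2 \<le> measure N (half_plane (- (\<i> * w)) c)}"
    by (auto simp: bisecting_frames_def bisects_def)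
  then show ?thesis by (simp only:) (intro convex_Int convex_superlevel_half_plane)
qed (simp add: bisecting_frames_def)

text \<open>
  If a quadrant carries less than a quarter of the mass, each of its two neighbours completes it to a
  half-plane of mass at least one half and so carries more than a quarter. Two adjacent quadrants
  are therefore never both small, and one of the two opposite pairs contains no small quadrant.
\<close>

lemma opposite_quadrants_large:
  assumes "(w, c) \<in> bisecting_frames"
  shows "mass / 4 \<le> measure N (quadrant w c) \<and> mass / 4 \<le> measure N (quadrant (- w) c) \<or>
    mass / 4 \<le> measure N (quadrant (\<i> * w) c) \<and> mass / 4 \<le> measure N (quadrant (- (\<i> * w)) c)"
proof -
  have "mass / 2 \<le> measure N (half_plane w c)" "mass / 2 \<le> measure N (half_plane (- w) c)"
    "mass / 2 \<le> measure N (half_plane (\<i> * w) c)" "mass / 2 \<le> measure N (half_plane (- (\<i> * w)) c)"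
    using assms by (auto simp: bisecting_frames_def bisects_def)
  moreover have "measure N (half_plane w c) \<le> measure N (quadrant w c) + measure N (quadrant (- (\<i> * w)) c)"
    "measure N (half_plane (- w) c) \<le> measure N (quadrant (- w) c) + measure N (quadrant (\<i> * w) c)"
    "measure N (half_plane (\<i> * w) c) \<le> measure N (quadrant (\<i> * w) c) + measure N (quadrant w c)"
    "measure N (half_plane (- (\<i> * w)) c) \<le> measure N (quadrant (- (\<i> * w)) c) + measure N (quadrant (- w) c)"
    using mass_half_plane_quadrants[of w c] mass_half_plane_quadrants[of "- w" c]
      mass_half_plane_quadrants[of "\<i> * w" c] mass_half_plane_quadrants[of "- (\<i> * w)" c]
    by simp_all
  ultimately show ?thesis by linarith
qed

text \<open>
  The connected space of bisecting frames is covered by two nonempty closed sets, one for each opposite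
  pair of quadrants that may be large; a frame in both has four large quadrants.
\<close>

theorem exists_equipartition:
  "\<exists>w c. norm w = 1 \<and> (\<forall>n. mass / 4 \<le> measure N (quadrant (\<i> ^ n * w) c))"
proof -
  define A where "A = {(w, c) \<in> bisecting_frames.
    mass / 4 \<le> measure N (quadrant w c) \<and> mass / 4 \<le> measure N (quadrant (- w) c)}"
  define B where "B = {(w, c) \<in> bisecting_frames.
    mass / 4 \<le> measure N (quadrant (\<i> * w) c) \<and> mass / 4 \<le> measure N (quadrant (- (\<i> * w)) c)}"
  have AB: "A \<union> B = bisecting_frames"
    using opposite_quadrants_large by (auto simp: A_def B_def)
  have "A = bisecting_frames \<inter> ({p. mass / 4 \<le> measure N (quadrant (fst p) (snd p))} \<inter>
      {p. mass / 4 \<le> measure N (quadrant (- fst p) (snd p))})"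
    by (auto simp: A_def)
  also have "compact \<dots>"
    by (intro compact_Int_closed compact_bisecting_frames closed_Int closed_superlevel_quadrant continuous_intros)
  finally have A: "compact A" .
  have "B = bisecting_frames \<inter> ({p. mass / 4 \<le> measure N (quadrant (\<i> * fst p) (snd p))} \<inter>
      {p. mass / 4 \<le> measure N (quadrant (- (\<i> * fst p)) (snd p))})"
    by (auto simp: B_def)
  also have "compact \<dots>"
    by (intro compact_Int_closed compact_bisecting_frames closed_Int closed_superlevel_quadrant continuous_intros)
  finally have B: "compact B" .
  \<comment> \<open>A quarter turn keeps the lines and shifts the labels of the quadrants by one,
    so it exchanges the two opposite pairs.\<close>
  have rot: "(\<i> * w, c) \<in> B" if "(w, c) \<in> A" for w c
    using that bisecting_frames_rotate by (auto simp: A_def B_def mult.assoc[symmetric])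
  have rot': "(\<i> * w, c) \<in> A" if "(w, c) \<in> B" for w c
    using that bisecting_frames_rotate by (auto simp: A_def B_def mult.assoc[symmetric])
  have base: "fst ` (A \<union> B) = sphere 0 1"
    unfolding AB using exists_bisecting_centre by (force simp: bisecting_frames_def image_iff)
  then have "A \<union> B \<noteq> {}" by (metis image_empty sphere_eq_empty not_one_less_zero)
  then have ne: "A \<noteq> {}" "B \<noteq> {}" using rot rot' by auto
  have "A \<inter> B \<noteq> {}"
  proof (rule compact_cover_connected_fibres_meet[OF A B _ _ ne])
    show "connected (fst ` (A \<union> B))"
      unfolding base by (rule connected_sphere) simp
    show "connected {c. (p, c) \<in> A \<union> B}" for p
      unfolding AB by (intro convex_connected convex_bisecting_centres)
  qed
  then obtain w c where wc: "(w, c) \<in> A \<inter> B" by auto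
  have "mass / 4 \<le> measure N (quadrant (\<i> ^ n * w) c) \<and> (\<i> ^ n * w, c) \<in> A \<inter> B" for n
  proof (induction n)
    case 0
    then show ?case using wc by (auto simp: A_def)
  next
    case (Suc n)
    then have "(\<i> ^ Suc n * w, c) \<in> A \<inter> B"
      using rot[of "\<i> ^ n * w" c] rot'[of "\<i> ^ n * w" c] by (auto simp: mult.assoc)
    then show ?case by (auto simp: A_def)
  qed
  moreover have "norm w = 1" using wc by (auto simp: A_def bisecting_frames_def)
  ultimately show ?thesis by blast
qed

end

section \<open>Value distribution of a measurable function\<close>

theorem theorem1p9:
  fixes M :: "'a measure" and I :: "'a set" and b :: "'a \<Rightarrow> complex"
  assumes "I \<in> sets M"
    and "emeasure M I < \<infinity>"
    and "b \<in> borel_measurable (restrict_space M I)"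
  shows "\<exists>L1 L2. orthogonal_lines L1 L2 \<and>
    (\<exists>T :: nat \<Rightarrow> complex set. bij_betw T {1, 2, 3, 4} (closed_quadrants L1 L2) \<and>
      (\<forall>i\<in>{1, 2, 3, 4}. measure M {x \<in> I. b x \<in> T i} \<ge> 1 / 16 * measure M I))"
proof -
  have "\<exists>w c. norm w = 1 \<and>
    (\<forall>n. measure M {x \<in> I. b x \<in> quadrant (\<i> ^ n * w) c} \<ge> 1 / 16 * measure M I)"
  proof (cases "measure M I = 0")
    case True
    then show ?thesis by (intro exI[of _ 1]) simp
  next
    case False
    define N where "N = distr (restrict_space M I) borel b"
    have sp: "space (restrict_space M I) = I"
      using sets.sets_into_space[OF assms(1)] by (auto simp: space_restrict_space)
    have N: "measure N S = measure M {x \<in> I. b x \<in> S}" if "S \<in> sets borel" for S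
    proof -
      have "measure N S = measure (restrict_space M I) (b -` S \<inter> I)"
        using assms(3) that by (simp add: N_def measure_distr sp)
      also have "\<dots> = measure M (b -` S \<inter> I)"
        using assms(1) by (intro measure_restrict_space) auto
      also have "b -` S \<inter> I = {x \<in> I. b x \<in> S}" by auto
      finally show ?thesis .
    qed
    have UNIV: "measure N UNIV = measure M I"
      using N[of UNIV] by simp
    interpret planar_mass N
    proof (intro planar_mass.intro planar_mass_axioms.intro)
      have "finite_measure (restrict_space M I)"
        using assms by (intro finite_measureI) (simp add: sp emeasure_restrict_space)
      then show "finite_measure N"
        unfolding N_def by (intro finite_measure.finite_measure_distr assms(3))
      show "sets N = sets borel" by (simp add: N_def)
      show "measure N UNIV > 0"
        unfolding UNIV using False by (simp add: zero_less_measure_iff)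
    qed
    obtain w c where w: "norm w = 1" and q: "\<And>n. measure N UNIV / 4 \<le> measure N (quadrant (\<i> ^ n * w) c)"
      using exists_equipartition by blast
    have "1 / 16 * measure M I \<le> measure M {x \<in> I. b x \<in> quadrant (\<i> ^ n * w) c}" for n
    proof -
      have "1 / 16 * measure M I \<le> measure M I / 4"
        using measure_nonneg[of M I] by simp
      also have "\<dots> \<le> measure M {x \<in> I. b x \<in> quadrant (\<i> ^ n * w) c}"
        using q[of n] N[of "quadrant (\<i> ^ n * w) c"] closed_quadrant UNIV by simp
      finally show ?thesis .
    qed
    with w show ?thesis by blast
  qed
  then obtain w c where w: "norm w = 1"
    and large: "\<And>n. measure M {x \<in> I. b x \<in> quadrant (\<i> ^ n * w) c} \<ge> 1 / 16 * measure M I"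
    by blast
  note frame = closed_quadrants_of_frame[OF w, of c]
  have "bij_betw (\<lambda>n. quadrant (\<i> ^ n * w) c) {1, 2, 3, 4}
      (closed_quadrants {z. w \<bullet> z = w \<bullet> c} {z. (\<i> * w) \<bullet> z = (\<i> * w) \<bullet> c})"
    using frame(3) frame(2)[symmetric] unfolding bij_betw_def by (rule conjI)
  with frame(1) large show ?thesis by blast
qed

end
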